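(* For all integers $d\geq 2$ and $q\geq 2$, every ordered $d$-degenerate graph $H^<$ on $n\geq 3$ vertices with at least one edge and with interval chromatic number $\chi$ satisfies \[ r_<(H^<;q)\leq n^{60d^{q-1}\lceil\log\chi\rceil^{q-1}}. \]
   Context: Logarithms are to base two. An ordered graph $G^<$ is a finite graph together with a linear order on its vertex set. An ordered copy of $H^<$ in $G^<$ is given by an increasing injection $f\colon V(H)\to V(G)$ with $f(u)f(v)\in E(G)$ whenever $uv\in E(H)$. The interval chromatic number of $G^<$ is the minimum number of intervals (of the vertex order) into which $V(G)$ can be partitioned so that no two vertices in the same interval are adjacent. A graph is $d$-degenerate if each of its nonempty subgraphs has a vertex of degree at most $d$. $K_N^<$ is the ordered complete graph on $N$ vertices. The ordered Ramsey number $r_<(H^<;q)$ is the smallest $N$ such that every coloring of the edges of $K_N^<$ with $q$ colors contains a monochromatic ordered copy of $H^<$. *)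

theory Defs
  imports Complex_Main "HOL-Library.FuncSet" "HOL-Library.Disjoint_Sets" "HOL-Library.Ramsey"
begin

text \<open>The vertex order is the order of the linearly ordered vertex type; edges are 2-element sets.\<close>

definition ordered_graph :: "'a::linorder set \<Rightarrow> 'a set set \<Rightarrow> bool" where
  "ordered_graph V E \<longleftrightarrow> finite V \<and> E \<subseteq> [V]\<^bsup>2\<^esup>"

definition vertex_degree :: "'a set set \<Rightarrow> 'a \<Rightarrow> nat" where
  "vertex_degree E v = card {e \<in> E. v \<in> e}"

text \<open>Subgraphs are arbitrary, not necessarily induced; nonempty means having a vertex.\<close>

definition degenerate :: "nat \<Rightarrow> 'a set \<Rightarrow> 'a set set \<Rightarrow> bool" where
  "degenerate d V E \<longleftrightarrow>
     (\<forall>W F. W \<noteq> {} \<and> W \<subseteq> V \<and> F \<subseteq> E \<and> F \<subseteq> [W]\<^bsup>2\<^esup> \<longrightarrow> (\<exists>v\<in>W. vertex_degree F v \<le> d))"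

definition interval_of :: "'a::linorder set \<Rightarrow> 'a set \<Rightarrow> bool" where
  "interval_of V I \<longleftrightarrow> I \<subseteq> V \<and> (\<forall>x\<in>I. \<forall>z\<in>I. \<forall>y\<in>V. x \<le> y \<and> y \<le> z \<longrightarrow> y \<in> I)"

definition interval_chromatic_number :: "'a::linorder set \<Rightarrow> 'a set set \<Rightarrow> nat" where
  "interval_chromatic_number V E =
     (LEAST k. \<exists>P. partition_on V P \<and> card P = k \<and>
        (\<forall>I\<in>P. interval_of V I \<and> indep I E))"

definition ordered_copy ::
  "('a::linorder \<Rightarrow> 'b::linorder) \<Rightarrow> 'a set \<Rightarrow> 'a set set \<Rightarrow> 'b set \<Rightarrow> 'b set set \<Rightarrow> bool" where
  "ordered_copy f V E W F \<longleftrightarrow>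
     strict_mono_on V f \<and> f ` V \<subseteq> W \<and> (\<forall>u\<in>V. \<forall>v\<in>V. {u, v} \<in> E \<longrightarrow> {f u, f v} \<in> F)"

text \<open>
  The ordered complete graph on \<open>N\<close> vertices is \<open>{..<N}\<close> with edge set \<open>[{..<N}]\<^bsup>2\<^esup>\<close>, and the
  colors are \<open>{..<q}\<close>. By Ramsey's theorem the minimum below is over a nonempty set of \<open>N\<close>
  for every ordered graph when \<open>q \<ge> 1\<close>.
\<close>

definition ordered_ramsey :: "'a::linorder set \<Rightarrow> 'a set set \<Rightarrow> nat \<Rightarrow> nat" where
  "ordered_ramsey V E q =
     (LEAST N. \<forall>c \<in> [{..<N}]\<^bsup>2\<^esup> \<rightarrow> {..<q}. \<exists>f. \<exists>i<q.
        ordered_copy f V E {..<N} ([{..<N}]\<^bsup>2\<^esup>) \<and> (\<forall>e\<in>E. c (f ` e) = i))"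

end

(*
Let k be the ceiling of log \<chi> and m = 2^k, and suppose that a coloring of K_N has no monochromatic
copy of H. The colors are made sparse one at a time. If the colors below t are very sparse between
m consecutive parts, embed the \<chi> intervals of H into the parts greedily in color t, in an order
witnessing d-degeneracy. A candidate set shrinks by a factor n^(a+1) at most d times, so the embedding
can only get stuck at two large sets A, B on opposite sides of a cut of the vertex order such that
every vertex of A has few neighbors of color at most t in B. Iterating this along a binary tree of
depth k (as in the Erdos-Hajnal type arguments of Fox and Sudakov) gives m consecutive parts, all pairs
of which are sparse in the colors at most t. Each color multiplies the exponent of n by about k d,
since a density n^(-a) for t + 1 colors needs density about n^(-da) for t colors at each of the k
levels. When q - 1 colors are sparse, H embeds in the last color.
*)
theory Submission
  imports Defs
begin

section \<open>Separated sets, sparse pairs, and blocks of a linear order\<close>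

definition set_less :: "'a::order set \<Rightarrow> 'a set \<Rightarrow> bool" (infix "\<lless>" 50) where
  "A \<lless> B \<longleftrightarrow> (\<forall>x\<in>A. \<forall>y\<in>B. x < y)"

text \<open>Density at most \<open>1 / p\<close>, written without division. The condition is
  one-sided: it passes to subsets of \<open>A\<close>, but not to subsets of
  \<open>B\<close>.\<close>

definition sparse :: "('a \<Rightarrow> 'b \<Rightarrow> bool) \<Rightarrow> nat \<Rightarrow> 'a set \<Rightarrow> 'b set \<Rightarrow> bool" where
  "sparse R p A B \<longleftrightarrow> (\<forall>x\<in>A. p * card {y\<in>B. R x y} \<le> card B)"

lemma set_less_mono: "A \<lless> B \<Longrightarrow> A' \<subseteq> A \<Longrightarrow> B' \<subseteq> B \<Longrightarrow> A' \<lless> B'"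
  by (auto simp: set_less_def)

text \<open>The blocks are consecutive index ranges of the sorted enumeration of \<open>A\<close>;
  the remainder at the top is dropped.\<close>

lemma split_into_blocks:
  fixes A :: "'a::linorder set"
  assumes "finite A"
  obtains W where "\<And>i. i < r \<Longrightarrow> W i \<subseteq> A" "\<And>i. i < r \<Longrightarrow> card (W i) = card A div r"
    "\<And>i j. i < j \<Longrightarrow> j < r \<Longrightarrow> W i \<lless> W j"
proof -
  define xs where "xs = sorted_list_of_set A"
  define b where "b = card A div r"
  define W where "W i = (\<lambda>l. xs ! l) ` {i * b..<i * b + b}" for i
  have len: "length xs = card A" and set: "set xs = A" and dist: "distinct xs"
    and srt: "sorted_wrt (<) xs"
    using assms by (auto simp: xs_def)
  have bound: "i * b + b \<le> card A" if "i < r" for i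
  proof -
    have "i * b + b = Suc i * b" by simp
    also have "\<dots> \<le> r * b" using that by (intro mult_le_mono1) simp
    also have "\<dots> \<le> card A" by (simp add: b_def)
    finally show ?thesis .
  qed
  show thesis
  proof
    fix i assume i: "i < r"
    show "W i \<subseteq> A"
    proof
      fix x assume "x \<in> W i"
      then obtain l where "x = xs ! l" "l < i * b + b" by (auto simp: W_def)
      with bound[OF i] show "x \<in> A" using len set nth_mem[of l xs] by auto
    qed
    have "inj_on (\<lambda>l. xs ! l) {i * b..<i * b + b}"
      using bound[OF i] dist len by (auto simp: inj_on_def nth_eq_iff_index_eq)
    then show "card (W i) = card A div r"
      by (simp add: W_def card_image b_def)
  next
    fix i j assume ij: "i < j" "j < r"
    have "i * b + b \<le> j * b"
      using ij mult_le_mono1[of "Suc i" j b] by simp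
    then show "W i \<lless> W j"
      using bound[OF ij(2)] len
      by (auto simp: set_less_def W_def intro!: sorted_wrt_nth_less[OF srt])
  qed
qed

lemma le_double_mult_div:
  assumes "r \<le> (x::nat)" "0 < r"
  shows "x \<le> 2 * r * (x div r)"
proof -
  have "1 \<le> x div r" using assms by (simp add: div_greater_zero_iff Suc_le_eq)
  then have "r * 1 \<le> r * (x div r)" by (intro mult_le_mono2)
  moreover have "x mod r < r" using assms by simp
  moreover have "x = r * (x div r) + x mod r" by simp
  ultimately show ?thesis by linarith
qed

section \<open>Averaging over sparse pairs\<close>

text \<open>
  Double counting the \<open>R\<close>-pairs: few vertices of \<open>B\<close> can see a fraction of more than \<open>1 / p\<close> of \<open>X\<close>.
\<close>

lemma markov_single:
  fixes R :: "'a \<Rightarrow> 'a \<Rightarrow> bool"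
  assumes fin: "finite X" "finite B" and sym: "\<And>x y. R x y \<Longrightarrow> R y x"
    and sp: "sparse R p' X B"
  shows "p' * card {y\<in>B. card X < p * card {x\<in>X. R y x}} \<le> p * card B"
proof (cases "X = {}")
  case False
  define D where "D = {y\<in>B. card X < p * card {x\<in>X. R y x}}"
  have D: "D \<subseteq> B" "finite D" using fin by (auto simp: D_def)
  have "card X * card D = (\<Sum>y\<in>D. card X)" by simp
  also have "\<dots> \<le> (\<Sum>y\<in>D. p * card {x\<in>X. R y x})"
    by (intro sum_mono) (auto simp: D_def)
  also have "\<dots> = p * (\<Sum>y\<in>D. \<Sum>x\<in>X. if R y x then 1 else 0)"
    using fin by (simp add: sum_distrib_left[symmetric] sum.If_cases Int_def)
  also have "\<dots> = p * (\<Sum>x\<in>X. \<Sum>y\<in>D. if R y x then 1 else 0)"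
    by (subst sum.swap) simp
  also have "\<dots> = p * (\<Sum>x\<in>X. card {y\<in>D. R y x})"
    using D by (simp add: sum.If_cases Int_def)
  finally have "p' * (card X * card D) \<le> p' * (p * (\<Sum>x\<in>X. card {y\<in>D. R y x}))" by simp
  also have "\<dots> = p * (\<Sum>x\<in>X. p' * card {y\<in>D. R y x})"
    by (simp add: sum_distrib_left mult.left_commute)
  also have "\<dots> \<le> p * (\<Sum>x\<in>X. card B)"
  proof (intro mult_le_mono2 sum_mono)
    fix x assume x: "x \<in> X"
    have "card {y\<in>D. R y x} \<le> card {y\<in>B. R x y}"
      using D fin sym by (intro card_mono) auto
    then have "p' * card {y\<in>D. R y x} \<le> p' * card {y\<in>B. R x y}" by simp
    also have "\<dots> \<le> card B" using sp x by (simp add: sparse_def)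
    finally show "p' * card {y\<in>D. R y x} \<le> card B" .
  qed
  finally have "card X * (p' * card D) \<le> card X * (p * card B)" by (simp add: algebra_simps)
  moreover have "0 < card X" using False fin by (simp add: card_gt_0_iff)
  ultimately show ?thesis by (simp only: D_def mult_le_cancel1)
qed simp

text \<open>Union bound: each member of \<open>F\<close> spoils at most a fraction
  \<open>p / p'\<close>, hence at most \<open>1 / (2 * r)\<close>, of \<open>B\<close>, so all of
  them together spoil at most half.\<close>

lemma markov_family:
  fixes R :: "'a \<Rightarrow> 'a \<Rightarrow> bool"
  assumes "finite B" and sym: "\<And>x y. R x y \<Longrightarrow> R y x"
    and F: "finite F" "card F \<le> r" "\<And>X. X \<in> F \<Longrightarrow> finite X" "\<And>X. X \<in> F \<Longrightarrow> sparse R p' X B"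
    and p: "2 * r * p \<le> p'" "0 < p" "0 < r"
  shows "card B \<le> 2 * card {y\<in>B. \<forall>X\<in>F. p * card {x\<in>X. R y x} \<le> card X}"
proof -
  define D where "D X = {y\<in>B. card X < p * card {x\<in>X. R y x}}" for X
  define G where "G = {y\<in>B. \<forall>X\<in>F. p * card {x\<in>X. R y x} \<le> card X}"
  have *: "B - G = (\<Union>X\<in>F. D X)" by (auto simp: G_def D_def not_le)
  have "2 * r * p * card (B - G) \<le> p' * card (B - G)" using p by (intro mult_le_mono1)
  also have "\<dots> \<le> p' * (\<Sum>X\<in>F. card (D X))"
    unfolding * using F by (intro mult_le_mono2 card_UN_le)
  also have "\<dots> = (\<Sum>X\<in>F. p' * card (D X))" by (simp add: sum_distrib_left)
  also have "\<dots> \<le> (\<Sum>X\<in>F. p * card B)"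
    unfolding D_def by (intro sum_mono markov_single[OF F(3) assms(1) sym F(4)])
  also have "\<dots> \<le> r * p * card B" using F by simp
  finally have "(r * p) * (2 * card (B - G)) \<le> (r * p) * card B" by (simp add: ac_simps)
  then have "2 * card (B - G) \<le> card B" using p by (simp only: mult_le_cancel1) simp
  moreover have "card B = card G + card (B - G)"
  proof -
    have "G \<subseteq> B" by (auto simp: G_def)
    then show ?thesis using \<open>finite B\<close>
      by (metis add.commute card_Diff_subset card_mono finite_subset le_add_diff_inverse2)
  qed
  ultimately show ?thesis unfolding G_def[symmetric] by linarith
qed

section \<open>Degenerate orderings\<close>

text \<open>For a member of a distinct list this counts the neighbors standing before it. The
  recursion peels off the head, as does the greedy embedding, which embeds the head first.\<close>

fun back_degree :: "'v set set \<Rightarrow> 'v list \<Rightarrow> 'v \<Rightarrow> nat" where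
  "back_degree E [] v = 0"
| "back_degree E (u # us) v =
     (if v = u then 0 else (if {u, v} \<in> E then 1 else 0) + back_degree E us v)"

lemma back_degree_append: "v \<in> set us \<Longrightarrow> back_degree E (us @ ws) v = back_degree E us v"
  by (induction us) auto

lemma back_degree_snoc:
  assumes "distinct us" "v \<notin> set us"
  shows "back_degree E (us @ [v]) v = card {u\<in>set us. {u, v} \<in> E}"
  using assms
proof (induction us)
  case (Cons u us)
  have "{w\<in>set (u # us). {w, v} \<in> E} =
    (if {u, v} \<in> E then insert u {w\<in>set us. {w, v} \<in> E} else {w\<in>set us. {w, v} \<in> E})"
    by auto
  then show ?case using Cons by auto
qed simp

text \<open>A vertex of small degree in the subgraph induced on \<open>S\<close> is placed last and
  the rest is ordered recursively; appending it does not change the other back degrees.\<close>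

lemma degenerate_ordering:
  assumes "finite V" "degenerate d V E"
  obtains vs where "distinct vs" "set vs = V" "\<And>v. v \<in> V \<Longrightarrow> back_degree E vs v \<le> d"
proof -
  have "\<exists>vs. distinct vs \<and> set vs = S \<and> (\<forall>v\<in>S. back_degree E vs v \<le> d)" if "S \<subseteq> V" for S
    using finite_subset[OF that assms(1)] that
  proof (induction S rule: finite_psubset_induct)
    case (psubset S)
    show ?case
    proof (cases "S = {}")
      case False
      define F where "F = {e \<in> E. e \<in> [S]\<^bsup>2\<^esup>}"
      obtain v where v: "v \<in> S" "vertex_degree F v \<le> d"
        using assms(2) False psubset.prems
        unfolding degenerate_def F_def by (metis (lifting) mem_Collect_eq subsetI)
      obtain vs where vs: "distinct vs" "set vs = S - {v}"
          "\<forall>w\<in>S - {v}. back_degree E vs w \<le> d"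
        using psubset.IH[of "S - {v}"] psubset.prems v by blast
      have "card {u\<in>set vs. {u, v} \<in> E} = card ((\<lambda>u. {u, v}) ` {u\<in>set vs. {u, v} \<in> E})"
        by (intro card_image[symmetric]) (auto simp: inj_on_def doubleton_eq_iff)
      also have "\<dots> \<le> card {e \<in> F. v \<in> e}"
      proof (intro card_mono)
        show "finite {e \<in> F. v \<in> e}"
          by (rule finite_subset[of _ "Pow S"]) (auto simp: F_def nsets_def psubset.hyps)
        show "(\<lambda>u. {u, v}) ` {u\<in>set vs. {u, v} \<in> E} \<subseteq> {e \<in> F. v \<in> e}"
          using v vs by (auto simp: F_def nsets_def)
      qed
      also have "\<dots> \<le> d" using v by (simp add: vertex_degree_def)
      finally have "back_degree E (vs @ [v]) v \<le> d" using vs by (simp add: back_degree_snoc)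
      moreover have "back_degree E (vs @ [v]) w \<le> d" if "w \<in> S - {v}" for w
        using that vs by (simp add: back_degree_append)
      ultimately have "distinct (vs @ [v]) \<and> set (vs @ [v]) = S \<and>
          (\<forall>w\<in>S. back_degree E (vs @ [v]) w \<le> d)"
        using vs v by auto
      then show ?thesis by blast
    qed simp
  qed
  from this[OF order.refl] show thesis using that by blast
qed

section \<open>Greedy embeddings\<close>

text \<open>
  The second alternative is the stuck state: at least a fraction \<open>1 / n\<close> of the candidates for \<open>u\<close>
  would shrink the candidate set of one and the same later neighbor \<open>w\<close> by more than \<open>M\<close>. The candidate
  set of \<open>w\<close> has then lost at most \<open>back_degree w - 1\<close> factors \<open>M\<close>, as \<open>u\<close> is not yet embedded; this
  is why \<open>M\<close> appears on the left, and it saves a factor in the exponent of the main recursion.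
\<close>

lemma greedy_embedding:
  fixes R :: "'b \<Rightarrow> 'b \<Rightarrow> bool"
  assumes sym: "\<And>x y. R x y \<Longrightarrow> R y x" and M: "0 < M"
    and E: "\<And>e. e \<in> E \<Longrightarrow> card e = 2"
    and "distinct vs" "length vs \<le> n" "\<And>v. v \<in> set vs \<Longrightarrow> finite (C v) \<and> C v \<noteq> {}"
  shows "(\<exists>f. (\<forall>v\<in>set vs. f v \<in> C v) \<and>
           (\<forall>u\<in>set vs. \<forall>v\<in>set vs. {u, v} \<in> E \<longrightarrow> R (f u) (f v))) \<or>
         (\<exists>u\<in>set vs. \<exists>w\<in>set vs. \<exists>A B. {u, w} \<in> E \<and> A \<subseteq> C u \<and> B \<subseteq> C w \<and>
            card (C u) \<le> M ^ back_degree E vs u * (n * card A) \<and>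
            M * card (C w) \<le> M ^ back_degree E vs w * card B \<and>
            (\<forall>x\<in>A. M * card {y\<in>B. R x y} < card B))"
  using assms(4-)
proof (induction vs arbitrary: C)
  case Nil
  then show ?case by simp
next
  case (Cons u us)
  define bad where "bad w = {x\<in>C u. M * card {y\<in>C w. R x y} < card (C w)}" for w
  define Nb where "Nb = {w\<in>set us. {u, w} \<in> E}"
  have Nb: "finite Nb" "card Nb \<le> n"
  proof -
    have "card Nb \<le> card (set us)" by (intro card_mono) (auto simp: Nb_def)
    also have "\<dots> \<le> n" using Cons.prems card_length[of us] by simp
    finally show "card Nb \<le> n" .
  qed (auto simp: Nb_def)
  show ?case
  proof (cases "\<exists>w\<in>Nb. card (C u) \<le> n * card (bad w)")
    case True
    then obtain w where w: "w \<in> Nb" "card (C u) \<le> n * card (bad w)" by blast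
    have "w \<noteq> u" using w Cons.prems by (auto simp: Nb_def)
    \<comment> \<open>Stuck at the head \<open>u\<close>, with no candidate set shrunk yet: the edge
      from \<open>u\<close> to \<open>w\<close> contributes 1 to the back degree of
      \<open>w\<close>, which pays for the \<open>M\<close> on the left.\<close>
    then have "M * card (C w) \<le> M ^ back_degree E (u # us) w * card (C w)"
      using w M by (simp add: Nb_def)
    then show ?thesis
      using w by (intro disjI2 bexI[of _ u] bexI[of _ w] exI[of _ "bad w"] exI[of _ "C w"])
        (auto simp: Nb_def bad_def)
  next
    case False
    \<comment> \<open>Each of the at most \<open>n\<close> later neighbors rules out less than a
      fraction \<open>1 / n\<close> of \<open>C u\<close>.\<close>
    have "\<exists>x\<in>C u. \<forall>w\<in>Nb. x \<notin> bad w"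
    proof (rule ccontr)
      assume "\<not> ?thesis"
      then have sub: "C u \<subseteq> (\<Union>w\<in>Nb. bad w)" by auto
      have Cu: "0 < card (C u)" using Cons.prems(3)[of u] by (simp add: card_gt_0_iff)
      have "Nb \<noteq> {}" using sub Cu by auto
      have "n * card (C u) \<le> n * (\<Sum>w\<in>Nb. card (bad w))"
      proof (intro mult_le_mono2)
        have "card (C u) \<le> card (\<Union>w\<in>Nb. bad w)"
          using sub Nb Cons.prems(3)[of u] by (intro card_mono) (auto simp: bad_def)
        also have "\<dots> \<le> (\<Sum>w\<in>Nb. card (bad w))" using Nb by (intro card_UN_le)
        finally show "card (C u) \<le> (\<Sum>w\<in>Nb. card (bad w))" .
      qed
      also have "\<dots> = (\<Sum>w\<in>Nb. n * card (bad w))" by (simp add: sum_distrib_left)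
      also have "\<dots> < (\<Sum>w\<in>Nb. card (C u))"
        using Nb \<open>Nb \<noteq> {}\<close> False by (intro sum_strict_mono) (auto simp: not_le)
      also have "\<dots> \<le> n * card (C u)" using Nb by simp
      finally show False by simp
    qed
    then obtain x where x: "x \<in> C u" "\<forall>w\<in>Nb. x \<notin> bad w" by blast
    define C' where "C' w = (if w \<in> Nb then {y\<in>C w. R x y} else C w)" for w
    have C'sub: "C' w \<subseteq> C w" for w by (auto simp: C'_def)
    have C'card: "card (C w) \<le> M ^ (if {u, w} \<in> E then 1 else 0) * card (C' w)"
      if "w \<in> set us" for w
      using that x by (auto simp: C'_def Nb_def bad_def not_less)
    have "finite (C' w) \<and> C' w \<noteq> {}" if "w \<in> set us" for w
    proof -
      have "finite (C w)" "0 < card (C w)"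
        using Cons.prems(3)[of w] that by (auto simp: card_gt_0_iff)
      then show ?thesis using C'card[OF that] finite_subset[OF C'sub] by fastforce
    qed
    then have "(\<exists>f. (\<forall>v\<in>set us. f v \<in> C' v) \<and>
           (\<forall>u\<in>set us. \<forall>v\<in>set us. {u, v} \<in> E \<longrightarrow> R (f u) (f v))) \<or>
         (\<exists>u\<in>set us. \<exists>w\<in>set us. \<exists>A B. {u, w} \<in> E \<and> A \<subseteq> C' u \<and> B \<subseteq> C' w \<and>
            card (C' u) \<le> M ^ back_degree E us u * (n * card A) \<and>
            M * card (C' w) \<le> M ^ back_degree E us w * card B \<and>
            (\<forall>x\<in>A. M * card {y\<in>B. R x y} < card B))"
      using Cons.prems by (intro Cons.IH) auto
    then show ?thesis
    proof (elim disjE exE bexE conjE)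
      fix f assume f: "\<forall>v\<in>set us. f v \<in> C' v"
        "\<forall>u\<in>set us. \<forall>v\<in>set us. {u, v} \<in> E \<longrightarrow> R (f u) (f v)"
      have nu: "u \<notin> set us" using Cons.prems by simp
      have Rx: "R x (f w)" if "w \<in> set us" "{u, w} \<in> E" for w
        using f(1) that by (auto simp: C'_def Nb_def split: if_splits)
      have Rxs: "R (f w) x" if "w \<in> set us" "{w, u} \<in> E" for w
        using Rx[of w] sym that by (simp add: insert_commute)
      have fC: "f v \<in> C v" if "v \<in> set us" for v using f(1) C'sub that by blast
      have "{u, u} \<notin> E" using E[of "{u, u}"] by auto
      then have "(\<forall>v\<in>set (u # us). (f(u := x)) v \<in> C v) \<and>
           (\<forall>v\<in>set (u # us). \<forall>w\<in>set (u # us). {v, w} \<in> E \<longrightarrow> R ((f(u := x)) v) ((f(u := x)) w))"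
        using f(2) fC nu x(1) Rx Rxs by auto
      then show ?thesis by blast
    next
      fix v w A B
      assume *: "v \<in> set us" "w \<in> set us" "{v, w} \<in> E" "A \<subseteq> C' v" "B \<subseteq> C' w"
        "card (C' v) \<le> M ^ back_degree E us v * (n * card A)"
        "M * card (C' w) \<le> M ^ back_degree E us w * card B"
        "\<forall>x\<in>A. M * card {y\<in>B. R x y} < card B"
      \<comment> \<open>\<open>e z\<close> bounds the number of factors \<open>M\<close> lost from
        \<open>C z\<close> to \<open>C' z\<close>, and is also the growth of the back degree of
        \<open>z\<close> when \<open>u\<close> is put in front.\<close>
      define e where "e z = (if {u, z} \<in> E then 1 else 0 :: nat)" for z
      have bd: "back_degree E (u # us) z = e z + back_degree E us z" if "z \<in> set us" for z
        using that Cons.prems by (auto simp: e_def)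
      have "card (C v) \<le> M ^ e v * card (C' v)" using C'card * by (simp add: e_def)
      also have "\<dots> \<le> M ^ e v * (M ^ back_degree E us v * (n * card A))"
        using * by (intro mult_le_mono2)
      also have "\<dots> = M ^ back_degree E (u # us) v * (n * card A)"
        using * by (simp add: bd power_add del: back_degree.simps)
      finally have 1: "card (C v) \<le> M ^ back_degree E (u # us) v * (n * card A)" .
      have "M * card (C w) \<le> M * (M ^ e w * card (C' w))"
        using C'card * by (intro mult_le_mono2) (simp add: e_def)
      also have "\<dots> = M ^ e w * (M * card (C' w))" by simp
      also have "\<dots> \<le> M ^ e w * (M ^ back_degree E us w * card B)"
        using * by (intro mult_le_mono2)
      also have "\<dots> = M ^ back_degree E (u # us) w * card B"
        using * by (simp add: bd power_add del: back_degree.simps)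
      finally have 2: "M * card (C w) \<le> M ^ back_degree E (u # us) w * card B" .
      have "A \<subseteq> C v" "B \<subseteq> C w" using * C'sub by blast+
      then show ?thesis
        using * 1 2
        by (intro disjI2 bexI[of _ v] bexI[of _ w] exI[of _ A] exI[of _ B] conjI)
          (assumption | rule list.set_intros(2))+
    qed
  qed
qed

text \<open>The vertices are embedded in arbitrary order: at most \<open>n\<close> earlier neighbors
  each forbid less than a fraction \<open>1 / n\<close> of \<open>W v\<close>. This serves the last
  color, with \<open>R\<close> collecting all the other colors.\<close>

lemma avoiding_embedding:
  fixes R :: "'b \<Rightarrow> 'b \<Rightarrow> bool"
  assumes sym: "\<And>x y. R x y \<Longrightarrow> R y x" and E: "\<And>e. e \<in> E \<Longrightarrow> card e = 2"
    and V: "finite V" "card V \<le> n" "\<And>v. v \<in> V \<Longrightarrow> finite (W v) \<and> W v \<noteq> {}"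
    and small: "\<And>u v x. u \<in> V \<Longrightarrow> v \<in> V \<Longrightarrow> {u, v} \<in> E \<Longrightarrow> x \<in> W u \<Longrightarrow>
      n * card {y\<in>W v. R x y} < card (W v)"
  obtains f where "\<And>v. v \<in> V \<Longrightarrow> f v \<in> W v"
    "\<And>u v. u \<in> V \<Longrightarrow> v \<in> V \<Longrightarrow> {u, v} \<in> E \<Longrightarrow> \<not> R (f u) (f v)"
proof -
  have "\<exists>f. (\<forall>v\<in>S. f v \<in> W v) \<and> (\<forall>u\<in>S. \<forall>v\<in>S. {u, v} \<in> E \<longrightarrow> \<not> R (f u) (f v))" if "S \<subseteq> V" for S
    using finite_subset[OF that V(1)] that
  proof (induction S rule: finite_induct)
    case (insert v S)
    then obtain f where f: "\<And>u. u \<in> S \<Longrightarrow> f u \<in> W u"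
      "\<And>u w. u \<in> S \<Longrightarrow> w \<in> S \<Longrightarrow> {u, w} \<in> E \<Longrightarrow> \<not> R (f u) (f w)" by blast
    define T where "T = {u\<in>S. {u, v} \<in> E}"
    define D where "D u = {y\<in>W v. R (f u) y}" for u
    have T: "finite T" "card T \<le> n"
    proof -
      have "card T \<le> card V" using insert V by (intro card_mono) (auto simp: T_def)
      then show "card T \<le> n" using V by simp
    qed (use insert in \<open>auto simp: T_def\<close>)
    have "\<exists>x\<in>W v. x \<notin> (\<Union>u\<in>T. D u)"
    proof (rule ccontr)
      assume "\<not> ?thesis"
      then have sub: "W v \<subseteq> (\<Union>u\<in>T. D u)" by blast
      have Wv: "finite (W v)" "W v \<noteq> {}" using insert V(3)[of v] by auto
      with sub have Tn: "T \<noteq> {}" by auto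
      have "card (W v) \<le> card (\<Union>u\<in>T. D u)"
        using sub T Wv by (intro card_mono) (auto simp: D_def)
      also have "\<dots> \<le> (\<Sum>u\<in>T. card (D u))" using T by (intro card_UN_le)
      finally have "n * card (W v) \<le> n * (\<Sum>u\<in>T. card (D u))" by (intro mult_le_mono2)
      also have "\<dots> = (\<Sum>u\<in>T. n * card (D u))" by (simp add: sum_distrib_left)
      also have "\<dots> < (\<Sum>u\<in>T. card (W v))"
        using T Tn insert.prems f small unfolding D_def T_def by (intro sum_strict_mono) auto
      also have "\<dots> \<le> n * card (W v)" using T by simp
      finally show False by simp
    qed
    then obtain x where x: "x \<in> W v" "\<And>u. u \<in> T \<Longrightarrow> \<not> R (f u) x" by (auto simp: D_def)
    have "{v, v} \<notin> E" using E[of "{v, v}"] by auto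
    moreover have "\<not> R (f u) x" "\<not> R x (f u)" if "u \<in> S" "{u, v} \<in> E" for u
      using x(2)[of u] sym that by (auto simp: T_def)
    ultimately have "(\<forall>u\<in>insert v S. (f(v := x)) u \<in> W u) \<and>
      (\<forall>u\<in>insert v S. \<forall>w\<in>insert v S. {u, w} \<in> E \<longrightarrow> \<not> R ((f(v := x)) u) ((f(v := x)) w))"
      using f x insert.hyps by (auto simp: insert_commute)
    then show ?case by blast
  qed simp
  from this[OF order.refl] show thesis using that by blast
qed

section \<open>Interval partitions as monotone labelings\<close>

text \<open>The partition into singletons shows that the minimum is attained and is at most
  \<open>card V\<close>; an optimal partition is then numbered from left to right.\<close>

lemma interval_classes:
  fixes V :: "'a::linorder set"
  assumes fin: "finite V" and E: "E \<subseteq> [V]\<^bsup>2\<^esup>" and chi: "interval_chromatic_number V E = \<chi>"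
  obtains p :: "'a \<Rightarrow> nat" where "\<chi> \<le> card V" "\<And>v. v \<in> V \<Longrightarrow> p v < \<chi>"
    "\<And>u v. u \<in> V \<Longrightarrow> v \<in> V \<Longrightarrow> u < v \<Longrightarrow> p u \<le> p v"
    "\<And>u v. u \<in> V \<Longrightarrow> v \<in> V \<Longrightarrow> {u, v} \<in> E \<Longrightarrow> p u \<noteq> p v"
proof -
  define Q where "Q k \<longleftrightarrow> (\<exists>P. partition_on V P \<and> card P = k \<and>
    (\<forall>I\<in>P. interval_of V I \<and> indep I E))" for k
  have chi': "\<chi> = (LEAST k. Q k)"
    using chi by (simp add: interval_chromatic_number_def Q_def)
  have "Q (card V)"
    unfolding Q_def
  proof (intro exI conjI ballI)
    show "partition_on V ((\<lambda>v. {v}) ` V)"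
      by (rule partition_onI) (auto simp: disjnt_def)
    show "card ((\<lambda>v. {v}) ` V) = card V" by (intro card_image) auto
    fix I assume "I \<in> (\<lambda>v. {v}) ` V"
    then show "interval_of V I" "indep I E" by (auto simp: interval_of_def indep_def)
  qed
  then have le: "\<chi> \<le> card V" and "Q \<chi>"
    unfolding chi' by (auto intro: Least_le LeastI)
  then obtain P where P: "partition_on V P" "card P = \<chi>"
    and int: "\<And>I. I \<in> P \<Longrightarrow> interval_of V I" and ind: "\<And>I. I \<in> P \<Longrightarrow> indep I E"
    by (auto simp: Q_def)
  have finP: "finite P" using P(1) fin finite_elements by blast
  \<comment> \<open>\<open>p v\<close> is the index of the interval of \<open>v\<close>, counted by the left endpoints up to \<open>v\<close>.\<close>
  define S where "S v = {I\<in>P. Min I \<le> v}" for v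
  define p where "p v = card (S v) - 1" for v
  have finS: "finite (S v)" for v using finP by (simp add: S_def)
  have block: "\<exists>I\<in>P. v \<in> I \<and> I \<in> S v" if "v \<in> V" for v
  proof -
    have "v \<in> \<Union>P" using partition_onD1[OF P(1)] that by simp
    then obtain I where I: "I \<in> P" "v \<in> I" by blast
    then have "I \<subseteq> V" using int by (auto simp: interval_of_def)
    then have "finite I" using fin finite_subset by blast
    then show ?thesis using I by (auto simp: S_def)
  qed
  have pos: "0 < card (S v)" if "v \<in> V" for v
    using block[OF that] finS by (auto simp: card_gt_0_iff)
  have mono: "p u \<le> p v" if "u < v" for u v
    unfolding p_def using that finS by (intro diff_le_mono card_mono) (auto simp: S_def)
  have strict: "p u < p v" if uv: "u \<in> V" "v \<in> V" "{u, v} \<in> E" "u < v" for u v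
  proof -
    obtain I where I: "I \<in> P" "v \<in> I" "I \<in> S v" using block uv by blast
    have "u \<notin> I" using ind[OF I(1)] I uv by (auto simp: indep_def)
    have "I \<subseteq> V" using int I by (auto simp: interval_of_def)
    then have "Min I \<in> I" using I fin finite_subset by (intro Min_in) auto
    \<comment> \<open>Otherwise \<open>u\<close> would lie between \<open>Min I\<close> and
      \<open>v\<close>, hence in the interval \<open>I\<close>.\<close>
    then have "\<not> Min I \<le> u"
      using int[OF I(1)] I(2) uv(1,4) \<open>u \<notin> I\<close> unfolding interval_of_def
      by (meson less_imp_le)
    then have "I \<notin> S u" by (simp add: S_def)
    then have "S u \<subset> S v" using I uv by (auto simp: S_def)
    then have "card (S u) < card (S v)" using finS by (intro psubset_card_mono)
    then show ?thesis using pos[OF uv(1)] by (simp add: p_def)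
  qed
  show thesis
  proof
    show "\<chi> \<le> card V" by (rule le)
    show "p v < \<chi>" if "v \<in> V" for v
    proof -
      have "card (S v) \<le> \<chi>" using P(2) finP by (auto simp: S_def intro!: card_mono)
      then show ?thesis using pos[OF that] by (simp add: p_def)
    qed
    show "p u \<le> p v" if "u < v" for u v using mono that .
    show "p u \<noteq> p v" if "u \<in> V" "v \<in> V" "{u, v} \<in> E" for u v
    proof (cases u v rule: linorder_cases)
      case equal
      then show ?thesis using E that by (auto simp: nsets_def)
    qed (use strict[of u v] strict[of v u] that in \<open>auto simp: insert_commute\<close>)
  qed
qed

section \<open>Colorings without a monochromatic copy\<close>

text \<open>
  \<open>p\<close> gives the index of the interval of a vertex; some of the \<open>m\<close> indices may be unused, as \<open>\<chi>\<close> is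
  rounded up to a power of two.
\<close>

locale ordered_coloring =
  fixes V :: "'a::linorder set" and E :: "'a set set" and d n k m q :: nat
    and p :: "'a \<Rightarrow> nat" and X :: "'b::linorder set" and c :: "'b set \<Rightarrow> nat"
  assumes finV: "finite V" and cardV: "card V = n" and n3: "3 \<le> n"
    and E: "E \<subseteq> [V]\<^bsup>2\<^esup>" and degen: "degenerate d V E"
    and m: "m = 2 ^ k" and m2: "2 * m \<le> n ^ 2"
    and p_less: "\<And>v. v \<in> V \<Longrightarrow> p v < m"
    and p_mono: "\<And>u v. u \<in> V \<Longrightarrow> v \<in> V \<Longrightarrow> u < v \<Longrightarrow> p u \<le> p v"
    and p_neq: "\<And>u v. u \<in> V \<Longrightarrow> v \<in> V \<Longrightarrow> {u, v} \<in> E \<Longrightarrow> p u \<noteq> p v"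
    and finX: "finite X"
    and no_copy: "\<And>f i. i < q \<Longrightarrow> ordered_copy f V E X ([X]\<^bsup>2\<^esup>) \<Longrightarrow> \<exists>e\<in>E. c (f ` e) \<noteq> i"
begin

text \<open>The first \<open>t\<close> colors merged into one relation; \<open>t\<close> counts the
  colors already made sparse.\<close>

abbreviation low :: "nat \<Rightarrow> 'b \<Rightarrow> 'b \<Rightarrow> bool" where
  "low t x y \<equiv> c {x, y} < t"

text \<open>The power \<open>n ^ s\<close> is both the size needed of \<open>U\<close> and the
  factor lost in passing to a part. Sparseness is demanded in both directions.\<close>

definition sparse_parts :: "nat \<Rightarrow> nat \<Rightarrow> nat \<Rightarrow> bool" where
  "sparse_parts t a s \<longleftrightarrow> (\<forall>U. U \<subseteq> X \<and> n ^ s \<le> card U \<longrightarrow>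
     (\<exists>P :: nat \<Rightarrow> 'b set. (\<forall>i<m. P i \<subseteq> U \<and> card U \<le> n ^ s * card (P i)) \<and>
        (\<forall>i<m. \<forall>j<m. i < j \<longrightarrow> P i \<lless> P j) \<and>
        (\<forall>i<m. \<forall>j<m. i \<noteq> j \<longrightarrow> sparse (low t) (n ^ a) (P i) (P j))))"

text \<open>What a stuck greedy embedding provides: sparseness in one direction only, with no
  control over which set comes first. Quantifying over all large \<open>U\<close> allows iteration
  inside \<open>A\<close> and \<open>B\<close>.\<close>

definition sparse_pair :: "nat \<Rightarrow> nat \<Rightarrow> nat \<Rightarrow> bool" where
  "sparse_pair t a g \<longleftrightarrow> (\<forall>U. U \<subseteq> X \<and> n ^ g \<le> card U \<longrightarrow>
     (\<exists>A B. A \<subseteq> U \<and> B \<subseteq> U \<and> card U \<le> n ^ g * card A \<and> card U \<le> n ^ g * card B \<and>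
        (A \<lless> B \<or> B \<lless> A) \<and> sparse (low t) (n ^ a) A B))"

lemma sparse_partsD:
  assumes "sparse_parts t a s" "U \<subseteq> X" "n ^ s \<le> card U"
  shows "\<exists>P :: nat \<Rightarrow> 'b set. (\<forall>i<m. P i \<subseteq> U) \<and> (\<forall>i<m. card U \<le> n ^ s * card (P i)) \<and>
        (\<forall>i<m. \<forall>j<m. i < j \<longrightarrow> P i \<lless> P j) \<and>
        (\<forall>i<m. \<forall>j<m. i \<noteq> j \<longrightarrow> sparse (low t) (n ^ a) (P i) (P j))"
proof -
  have "\<exists>P :: nat \<Rightarrow> 'b set. (\<forall>i<m. P i \<subseteq> U \<and> card U \<le> n ^ s * card (P i)) \<and>
        (\<forall>i<m. \<forall>j<m. i < j \<longrightarrow> P i \<lless> P j) \<and>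
        (\<forall>i<m. \<forall>j<m. i \<noteq> j \<longrightarrow> sparse (low t) (n ^ a) (P i) (P j))"
    using assms unfolding sparse_parts_def by simp
  then show ?thesis by (elim ex_forward) simp
qed

lemma low_sym: "low t x y \<Longrightarrow> low t y x"
  by (simp add: insert_commute)

lemma card_edge: "e \<in> E \<Longrightarrow> card e = 2"
  using E by (auto simp: nsets_def)

lemma edge_vertices: "{u, v} \<in> E \<Longrightarrow> u \<in> V \<and> v \<in> V \<and> u \<noteq> v"
  using E by (auto simp: nsets_def)

lemma power_le_card_factor:
  assumes "n ^ (a + b) \<le> x" "x \<le> n ^ a * y"
  shows "n ^ b \<le> y"
proof -
  have "n ^ a * n ^ b \<le> n ^ a * y" using assms unfolding power_add by (rule le_trans)
  then show ?thesis using n3 by (subst (asm) mult_le_cancel1) auto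
qed

text \<open>
  Giving each vertex its own block of its part makes every transversal order preserving.
\<close>

lemma blocks:
  fixes P :: "nat \<Rightarrow> 'b set"
  assumes "\<forall>i<m. P i \<subseteq> X" "\<forall>i<m. n \<le> card (P i)"
    "\<forall>i<m. \<forall>j<m. i < j \<longrightarrow> P i \<lless> P j"
  shows "\<exists>W. (\<forall>v\<in>V. W v \<subseteq> P (p v)) \<and> (\<forall>v\<in>V. card (P (p v)) \<le> n ^ 2 * card (W v)) \<and>
    (\<forall>v\<in>V. W v \<noteq> {}) \<and> (\<forall>u\<in>V. \<forall>v\<in>V. u < v \<longrightarrow> W u \<lless> W v)"
proof -
  note P = assms[rule_format]
  have "\<exists>D. (\<forall>i<n. D i \<subseteq> P l) \<and> (\<forall>i<n. card (D i) = card (P l) div n) \<and>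
      (\<forall>i j. i < j \<longrightarrow> j < n \<longrightarrow> D i \<lless> D j)" if "l < m" for l
    using split_into_blocks[of "P l" n] finite_subset[OF P(1)[OF that] finX] by metis
  then obtain D where D: "\<And>l i. l < m \<Longrightarrow> i < n \<Longrightarrow> D l i \<subseteq> P l"
    "\<And>l i. l < m \<Longrightarrow> i < n \<Longrightarrow> card (D l i) = card (P l) div n"
    "\<And>l i j. l < m \<Longrightarrow> i < j \<Longrightarrow> j < n \<Longrightarrow> D l i \<lless> D l j"
    by metis
  \<comment> \<open>The rank in all of \<open>V\<close> selects the block, so vertices with equal
    labels get blocks in their own order.\<close>
  define rk where "rk v = card {u\<in>V. u < v}" for v
  have rk: "rk v < n" if "v \<in> V" for v
    unfolding rk_def cardV[symmetric] using that finV by (intro psubset_card_mono) auto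
  have rk_mono: "rk u < rk v" if "u \<in> V" "u < v" for u v
    unfolding rk_def using that finV by (intro psubset_card_mono) auto
  define W where "W v = D (p v) (rk v)" for v
  have big: "card (P (p v)) \<le> n ^ 2 * card (W v)" if v: "v \<in> V" for v
  proof -
    have "card (P (p v)) \<le> 2 * n * (card (P (p v)) div n)"
      using P(2) p_less v n3 by (intro le_double_mult_div) auto
    also have "\<dots> \<le> n * n * (card (P (p v)) div n)" using n3 by (intro mult_le_mono1) simp
    finally show ?thesis using D(2) p_less rk v by (simp add: W_def power2_eq_square)
  qed
  show ?thesis
  proof (intro exI[of _ W] conjI ballI impI)
    fix v assume that: "v \<in> V"
    show "W v \<subseteq> P (p v)" using D(1) p_less rk that by (simp add: W_def)
    show "card (P (p v)) \<le> n ^ 2 * card (W v)" using big that .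
    show "W v \<noteq> {}"
      using big[OF that] P(2)[OF p_less[OF that]] n3 by auto
  next
    fix u v assume uv: "u \<in> V" "v \<in> V" "u < v"
    show "W u \<lless> W v"
    proof (cases "p u = p v")
      case True
      then show ?thesis using D(3) p_less rk rk_mono uv by (simp add: W_def)
    next
      case False
      then have less: "P (p u) \<lless> P (p v)" using p_mono[OF uv] P(3) p_less uv by simp
      then show ?thesis
        using set_less_mono[OF less] D(1) p_less rk uv by (simp add: W_def)
    qed
  qed
qed

lemma ordered_copyI:
  assumes "\<And>v. v \<in> V \<Longrightarrow> f v \<in> W v" "\<And>v. v \<in> V \<Longrightarrow> W v \<subseteq> X"
    "\<And>u v. u \<in> V \<Longrightarrow> v \<in> V \<Longrightarrow> u < v \<Longrightarrow> W u \<lless> W v"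
  shows "ordered_copy f V E X ([X]\<^bsup>2\<^esup>)"
proof -
  have less: "f u < f v" if "u \<in> V" "v \<in> V" "u < v" for u v
    using assms(1,3) that by (auto simp: set_less_def)
  have "f u \<noteq> f v" if "{u, v} \<in> E" for u v
    using less[of u v] less[of v u] edge_vertices[OF that]
    by (cases u v rule: linorder_cases) auto
  moreover have "f v \<in> X" if "v \<in> V" for v using assms(1,2) that by blast
  ultimately show ?thesis
    using less by (auto simp: ordered_copy_def strict_mono_on_def nsets_def)
qed

lemma no_monochromatic_transversal:
  assumes f: "\<And>v. v \<in> V \<Longrightarrow> f v \<in> W v" "\<And>v. v \<in> V \<Longrightarrow> W v \<subseteq> X"
    "\<And>u v. u \<in> V \<Longrightarrow> v \<in> V \<Longrightarrow> u < v \<Longrightarrow> W u \<lless> W v"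
    and i: "i < q"
  shows "\<exists>u v. {u, v} \<in> E \<and> c {f u, f v} \<noteq> i"
proof -
  obtain e where e: "e \<in> E" "c (f ` e) \<noteq> i" using no_copy[OF i ordered_copyI[of f W]] f by blast
  from card_edge[OF e(1)] obtain u v where "e = {u, v}" by (auto simp: card_2_iff)
  then show ?thesis using e by auto
qed

section \<open>Making one more color sparse\<close>

text \<open>No color is below 0, so sparseness is trivial and equal blocks suffice; rounding costs
  \<open>2 * m\<close>, at most \<open>n ^ 2\<close>.\<close>

lemma sparse_parts_0: "sparse_parts 0 a 2"
  unfolding sparse_parts_def
proof (intro allI impI, elim conjE)
  fix U assume U: "U \<subseteq> X" "n ^ 2 \<le> card U"
  obtain P where P: "\<And>i. i < m \<Longrightarrow> P i \<subseteq> U" "\<And>i. i < m \<Longrightarrow> card (P i) = card U div m"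
    "\<And>i j. i < j \<Longrightarrow> j < m \<Longrightarrow> P i \<lless> P j"
    using split_into_blocks[of U m] finite_subset[OF U(1) finX] by metis
  have "card U \<le> 2 * m * (card U div m)"
    using U m2 by (intro le_double_mult_div) (auto simp: m)
  also have "\<dots> \<le> n ^ 2 * (card U div m)" using m2 by (intro mult_le_mono1)
  finally show "\<exists>P. (\<forall>i<m. P i \<subseteq> U \<and> card U \<le> n ^ 2 * card (P i)) \<and>
        (\<forall>i<m. \<forall>j<m. i < j \<longrightarrow> P i \<lless> P j) \<and>
        (\<forall>i<m. \<forall>j<m. i \<noteq> j \<longrightarrow> sparse (low 0) (n ^ a) (P i) (P j))"
    using P by (intro exI[of _ P]) (auto simp: sparse_def)
qed

text \<open>The greedy embedding in color \<open>t\<close> must get stuck, and the stuck pair is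
  sparse in color \<open>t\<close>. The lower colors stay sparse because the parts were sparse
  enough to survive the shrinking. The size exponent adds \<open>s\<close> for the parts, 2 for the
  blocks, and \<open>d * (a + 1) + 1\<close> for the stuck pair.\<close>

lemma sparse_pair_step:
  assumes S: "sparse_parts t (d * (a + 1) + 2) s" and t: "t < q"
  shows "sparse_pair (Suc t) a (s + d * (a + 1) + 3)"
  unfolding sparse_pair_def
proof (intro allI impI, elim conjE)
  define g where "g = s + d * (a + 1) + 3"
  \<comment> \<open>The spare factor \<open>n\<close> over \<open>n ^ a\<close> absorbs the 2 that
    arises when color \<open>t\<close> is added to the lower colors.\<close>
  define M where "M = n ^ (a + 1)"
  have M: "0 < M" "M ^ d = n ^ (d * (a + 1))"
    using n3 by (simp_all only: M_def power_mult[symmetric] mult.commute) simp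
  fix U assume U: "U \<subseteq> X" "n ^ (s + d * (a + 1) + 3) \<le> card U"
  have "n ^ s \<le> n ^ (s + d * (a + 1) + 3)" using n3 by (intro power_increasing) auto
  then have "n ^ s \<le> card U" using U(2) by (rule le_trans)
  from sparse_partsD[OF S U(1) this] obtain P :: "nat \<Rightarrow> 'b set" where P': "\<forall>i<m. P i \<subseteq> U"
    "\<forall>i<m. card U \<le> n ^ s * card (P i)" "\<forall>i<m. \<forall>j<m. i < j \<longrightarrow> P i \<lless> P j"
    "\<forall>i<m. \<forall>j<m. i \<noteq> j \<longrightarrow> sparse (low t) (n ^ (d * (a + 1) + 2)) (P i) (P j)"
    by blast
  note P = P'[rule_format]
  have PX: "\<forall>i<m. P i \<subseteq> X" using order.trans[OF P(1) U(1)] by simp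
  have "\<forall>i<m. n \<le> card (P i)"
  proof (intro allI impI)
    fix i assume that: "i < m"
    have "n ^ (d * (a + 1) + 3) \<le> card (P i)"
      using power_le_card_factor[OF _ P(2)[OF that], of "d * (a + 1) + 3"] U(2)
      by (simp only: add.assoc)
    moreover have "n ^ 1 \<le> n ^ (d * (a + 1) + 3)" using n3 by (intro power_increasing) auto
    ultimately show "n \<le> card (P i)" by simp
  qed
  from blocks[OF PX this P'(3)] obtain W where W': "\<forall>v\<in>V. W v \<subseteq> P (p v)"
    "\<forall>v\<in>V. card (P (p v)) \<le> n ^ 2 * card (W v)" "\<forall>v\<in>V. W v \<noteq> {}"
    "\<forall>u\<in>V. \<forall>v\<in>V. u < v \<longrightarrow> W u \<lless> W v"
    by blast
  note W = W'[rule_format]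
  have WX: "W v \<subseteq> X" and WU: "W v \<subseteq> U" if "v \<in> V" for v
    using W(1)[OF that] P(1)[OF p_less[OF that]] U by auto
  have finW: "finite (W v)" if "v \<in> V" for v using finite_subset[OF WX[OF that] finX] .
  obtain vs where vs: "distinct vs" "set vs = V" "\<And>v. v \<in> V \<Longrightarrow> back_degree E vs v \<le> d"
    by (rule degenerate_ordering[OF finV degen]) blast
  have len: "length vs \<le> n" using vs cardV distinct_card[of vs] by simp
  have "(\<exists>f. (\<forall>v\<in>set vs. f v \<in> W v) \<and>
           (\<forall>u\<in>set vs. \<forall>v\<in>set vs. {u, v} \<in> E \<longrightarrow> c {f u, f v} = t)) \<or>
         (\<exists>u\<in>set vs. \<exists>w\<in>set vs. \<exists>A B. {u, w} \<in> E \<and> A \<subseteq> W u \<and> B \<subseteq> W w \<and>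
            card (W u) \<le> M ^ back_degree E vs u * (n * card A) \<and>
            M * card (W w) \<le> M ^ back_degree E vs w * card B \<and>
            (\<forall>x\<in>A. M * card {y\<in>B. c {x, y} = t} < card B))"
    using vs len finW W(3) M(1) card_edge
    by (intro greedy_embedding) (auto simp: insert_commute)
  then show "\<exists>A B. A \<subseteq> U \<and> B \<subseteq> U \<and> card U \<le> n ^ (s + d * (a + 1) + 3) * card A \<and>
      card U \<le> n ^ (s + d * (a + 1) + 3) * card B \<and>
      (A \<lless> B \<or> B \<lless> A) \<and> sparse (low (Suc t)) (n ^ a) A B"
  proof (elim disjE exE bexE conjE)
    fix f assume f: "\<forall>v\<in>set vs. f v \<in> W v"
      "\<forall>u\<in>set vs. \<forall>v\<in>set vs. {u, v} \<in> E \<longrightarrow> c {f u, f v} = t"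
    have "\<exists>u v. {u, v} \<in> E \<and> c {f u, f v} \<noteq> t"
      using f(1) vs(2) by (intro no_monochromatic_transversal[OF _ WX W(4) t]) auto
    then show ?thesis
      using f(2) vs(2) edge_vertices by blast
  next
    fix u w A B
    assume "u \<in> set vs" "w \<in> set vs" and e: "{u, w} \<in> E" and A: "A \<subseteq> W u" and B: "B \<subseteq> W w"
      and cA: "card (W u) \<le> M ^ back_degree E vs u * (n * card A)"
      and cB: "M * card (W w) \<le> M ^ back_degree E vs w * card B"
      and deg: "\<forall>x\<in>A. M * card {y\<in>B. c {x, y} = t} < card B"
    then have V: "u \<in> V" "w \<in> V" using vs by auto
    have finB: "finite B" using B finW V finite_subset by blast
    have Md: "M ^ back_degree E vs v \<le> M ^ d" if "v \<in> V" for v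
      using vs(3)[OF that] M(1) by (intro power_increasing) auto
    have cA': "card (W u) \<le> M ^ d * (n * card A)"
      using cA mult_le_mono1[OF Md[OF V(1)], of "n * card A"] by linarith
    have cB': "M * card (W w) \<le> M ^ d * card B"
      using cB mult_le_mono1[OF Md[OF V(2)], of "card B"] by linarith
    have UW: "card U \<le> n ^ (s + 2) * card (W v)" if "v \<in> V" for v
    proof -
      have "card U \<le> n ^ s * card (P (p v))" using P(2) p_less that by blast
      also have "\<dots> \<le> n ^ s * (n ^ 2 * card (W v))" using W(2)[OF that] by (intro mult_le_mono2)
      finally show ?thesis by (simp add: power_add power2_eq_square ac_simps)
    qed
    have "card U \<le> n ^ (s + 2) * card (W u)" using UW V by blast
    also have "\<dots> \<le> n ^ (s + 2) * (M ^ d * (n * card A))" using cA' by (intro mult_le_mono2)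
    also have "\<dots> = n ^ g * card A" by (simp add: M(2) g_def power_add eval_nat_numeral)
    finally have UA: "card U \<le> n ^ g * card A" .
    have "1 * card (W w) \<le> M * card (W w)" using M(1) by (intro mult_le_mono1) simp
    then have "card (W w) \<le> M ^ d * card B" using cB' by linarith
    then have "n ^ (s + 2) * card (W w) \<le> n ^ (s + 2) * (M ^ d * card B)" by (intro mult_le_mono2)
    with UW[OF V(2)] have "card U \<le> n ^ (s + 2) * (M ^ d * card B)" by linarith
    also have "\<dots> = n ^ (s + d * (a + 1) + 2) * card B" by (simp add: M(2) power_add)
    also have "\<dots> \<le> n ^ g * card B"
      using n3 by (intro mult_le_mono1 power_increasing) (auto simp: g_def)
    finally have UB: "card U \<le> n ^ g * card B" .
    have "u \<noteq> w" using edge_vertices e by blast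
    then have "W u \<lless> W w \<or> W w \<lless> W u" using W(4) V by (metis linorder_neqE)
    then have ord: "A \<lless> B \<or> B \<lless> A" using A B set_less_mono by blast
    have "sparse (low (Suc t)) (n ^ a) A B"
      unfolding sparse_def
    proof
      fix x assume x: "x \<in> A"
      define D where "D = {y\<in>B. low t x y}"
      have "n ^ (d * (a + 1) + 2) * card D \<le> n ^ (d * (a + 1) + 2) * card {y\<in>P (p w). low t x y}"
        using W(1)[OF V(2)] P(1)[OF p_less[OF V(2)]] U B finX
        by (intro mult_le_mono2 card_mono) (auto simp: D_def intro: finite_subset)
      also have "\<dots> \<le> card (P (p w))"
        using P(4)[of "p u" "p w"] p_less V p_neq[OF V e] x A W(1)[OF V(1)]
        by (auto simp: sparse_def)
      also have "\<dots> \<le> n ^ 2 * card (W w)" using W(2) V by blast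
      finally have "n ^ 2 * (M ^ d * card D) \<le> n ^ 2 * card (W w)"
        unfolding M(2) power_add by (simp only: ac_simps)
      then have "M ^ d * card D \<le> card (W w)" using n3 by simp
      \<comment> \<open>Here the saved factor \<open>M\<close> enters: \<open>B\<close> has lost at
        most \<open>d - 1\<close> factors, so the lower colors keep density \<open>1 / M\<close> in
        \<open>B\<close>.\<close>
      then have "M * (M ^ d * card D) \<le> M * card (W w)" by (rule mult_le_mono2)
      then have "M * (M ^ d * card D) \<le> M ^ d * card B" using cB' by (rule le_trans)
      then have "M ^ d * (M * card D) \<le> M ^ d * card B" by (simp only: mult.left_commute)
      then have 1: "M * card D \<le> card B" using M(1) by simp
      have "card {y\<in>B. low (Suc t) x y} \<le> card (D \<union> {y\<in>B. c {x, y} = t})"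
        using finB by (intro card_mono) (auto simp: D_def)
      also have "\<dots> \<le> card D + card {y\<in>B. c {x, y} = t}" by (rule card_Un_le)
      finally have "M * card {y\<in>B. low (Suc t) x y} \<le> M * (card D + card {y\<in>B. c {x, y} = t})"
        by (rule mult_le_mono2)
      also have "\<dots> \<le> card B + card B"
        using 1 deg x unfolding distrib_left by (intro add_mono) auto
      also have "\<dots> \<le> n * card B" using mult_le_mono1[of 2 n "card B"] n3 by linarith
      finally show "n ^ a * card {y\<in>B. low (Suc t) x y} \<le> card B"
        using n3 by (simp add: M_def)
    qed
    then show ?thesis using A B WU V UA UB ord unfolding g_def by blast
  qed
qed

text \<open>Each level costs \<open>g\<close> for the pair and 1 for halving \<open>B\<close>. The
  \<open>b + 2\<close> leaves room for the factor \<open>2 * m\<close> in Markov's inequality, and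
  \<open>b\<close> is the same at every level. The list follows the vertex order, whereas the
  direction of sparseness depends on which of \<open>A\<close> and \<open>B\<close> came
  first.\<close>

lemma sparse_tree:
  assumes D: "sparse_pair t (b + 2) g"
    and "2 ^ j \<le> m" "U \<subseteq> X" "n ^ (j * (g + 1)) \<le> card U"
  shows "\<exists>L. length L = 2 ^ j \<and>
    sorted_wrt (\<lambda>P Q. P \<lless> Q \<and> (sparse (low t) (n ^ b) P Q \<or> sparse (low t) (n ^ b) Q P)) L \<and>
    (\<forall>P\<in>set L. P \<subseteq> U \<and> card U \<le> n ^ (j * (g + 1)) * card P)"
  using assms(2-)
proof (induction j arbitrary: U)
  case 0
  then show ?case by (intro exI[of _ "[U]"]) simp
next
  case (Suc j)
  define h where "h = j * (g + 1)"
  have h: "Suc j * (g + 1) = g + (h + 1)" by (simp add: h_def)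
  have "n ^ g \<le> n ^ (Suc j * (g + 1))" using n3 by (intro power_increasing) auto
  then obtain A B where AB: "A \<subseteq> U" "B \<subseteq> U" "card U \<le> n ^ g * card A" "card U \<le> n ^ g * card B"
    and ord: "A \<lless> B \<or> B \<lless> A" and sp: "sparse (low t) (n ^ (b + 2)) A B"
    using D Suc.prems unfolding sparse_pair_def by (meson le_trans)
  have cA: "n ^ (h + 1) \<le> card A" and cB: "n ^ (h + 1) \<le> card B"
    using power_le_card_factor AB(3,4) Suc.prems(3) unfolding h by blast+
  have "n ^ h \<le> card A"
    using cA power_increasing[of h "h + 1" n] n3 by linarith
  moreover have pow: "2 ^ j \<le> m" and subX: "A \<subseteq> X" "{y\<in>B. Q y} \<subseteq> X" for Q
    using Suc.prems(1,2) AB by auto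
  ultimately obtain LA where LA: "length LA = 2 ^ j"
    "sorted_wrt (\<lambda>P Q. P \<lless> Q \<and> (sparse (low t) (n ^ b) P Q \<or> sparse (low t) (n ^ b) Q P)) LA"
    "\<forall>P\<in>set LA. P \<subseteq> A \<and> card A \<le> n ^ h * card P"
    using Suc.IH[of A, folded h_def] pow subX(1) by blast
  \<comment> \<open>Sparseness from \<open>A\<close> to \<open>B\<close> does not survive passing to small subsets of \<open>B\<close>, so \<open>A\<close> is subdivided
    first, and \<open>B\<close> is then restricted to the vertices that are sparse towards all the parts of \<open>A\<close>.\<close>
  define B' where "B' = {y\<in>B. \<forall>P\<in>set LA. n ^ b * card {x\<in>P. low t y x} \<le> card P}"
  have "card B \<le> 2 * card B'"
    unfolding B'_def
  proof (rule markov_family[where p' = "n ^ (b + 2)" and r = m])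
    show "finite B" using AB Suc.prems finX by (meson finite_subset)
    show "card (set LA) \<le> m" using card_length[of LA] LA(1) Suc.prems(1) by simp
    fix P assume P: "P \<in> set LA"
    show "finite P" using P LA AB Suc.prems finX by (meson finite_subset)
    show "sparse (low t) (n ^ (b + 2)) P B" using sp P LA(3) by (auto simp: sparse_def)
  next
    have "2 * m * n ^ b \<le> n ^ 2 * n ^ b" using m2 by (rule mult_le_mono1)
    then show "2 * m * n ^ b \<le> n ^ (b + 2)" by (simp only: power_add mult.commute[of "n ^ b"])
  qed (use n3 in \<open>auto simp: low_sym m insert_commute\<close>)
  also have "\<dots> \<le> n * card B'" using n3 by (intro mult_le_mono1) simp
  finally have cB': "card B \<le> n * card B'" .
  have "n ^ h \<le> card B'"
    using power_le_card_factor[of 1 h "card B" "card B'"] cB cB' by simp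
  moreover have "B' \<subseteq> X" unfolding B'_def by (rule subX)
  ultimately obtain LB where LB: "length LB = 2 ^ j"
    "sorted_wrt (\<lambda>P Q. P \<lless> Q \<and> (sparse (low t) (n ^ b) P Q \<or> sparse (low t) (n ^ b) Q P)) LB"
    "\<forall>P\<in>set LB. P \<subseteq> B' \<and> card B' \<le> n ^ h * card P"
    using Suc.IH[of B', folded h_def] pow by blast
  have cross: "sparse (low t) (n ^ b) Q P" if "P \<in> set LA" "Q \<in> set LB" for P Q
    using that LB(3) by (auto simp: sparse_def B'_def)
  have sub: "P \<in> set LA \<Longrightarrow> P \<subseteq> A" "P \<in> set LB \<Longrightarrow> P \<subseteq> B" for P
    using LA(3) LB(3) by (auto simp: B'_def)
  have size: "P \<subseteq> U \<and> card U \<le> n ^ (Suc j * (g + 1)) * card P" if "P \<in> set LA \<union> set LB" for P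
    using that
  proof
    assume P: "P \<in> set LA"
    have "card U \<le> n ^ g * card A" by (rule AB)
    also have "\<dots> \<le> n ^ g * (n ^ h * card P)" using LA(3) P by (intro mult_le_mono2) auto
    \<comment> \<open>Padding by \<open>n\<close>, so that both halves satisfy the same
      bound.\<close>
    also have "\<dots> \<le> n * (n ^ g * (n ^ h * card P))" using n3 by simp
    finally have "card U \<le> n ^ (Suc j * (g + 1)) * card P" unfolding h by (simp add: power_add ac_simps)
    then show ?thesis using sub(1)[OF P] AB(1) by blast
  next
    assume P: "P \<in> set LB"
    have "card U \<le> n ^ g * card B" by (rule AB)
    also have "\<dots> \<le> n ^ g * (n * card B')" using cB' by (intro mult_le_mono2)
    also have "\<dots> \<le> n ^ g * (n * (n ^ h * card P))"
      using LB(3) P by (intro mult_le_mono2) auto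
    finally have "card U \<le> n ^ (Suc j * (g + 1)) * card P" unfolding h by (simp add: power_add ac_simps)
    then show ?thesis using sub(2)[OF P] AB(2) by blast
  qed
  then have all: "\<forall>P\<in>set LA \<union> set LB. P \<subseteq> U \<and> card U \<le> n ^ (Suc j * (g + 1)) * card P"
    by blast
  from ord show ?case
  proof
    assume less: "A \<lless> B"
    have "P \<lless> Q" if "P \<in> set LA" "Q \<in> set LB" for P Q
      using set_less_mono[OF less] sub that by simp
    then show ?thesis
      using LA(1,2) LB(1,2) cross all
      by (intro exI[of _ "LA @ LB"]) (simp add: sorted_wrt_append ball_Un)
  next
    assume less: "B \<lless> A"
    have "P \<lless> Q" if "P \<in> set LB" "Q \<in> set LA" for P Q
      using set_less_mono[OF less] sub that by simp
    then show ?thesis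
      using LA(1,2) LB(1,2) cross all
      by (intro exI[of _ "LB @ LA"]) (simp add: sorted_wrt_append ball_Un)
  qed
qed

text \<open>
  The tree only gives sparseness in one direction for each pair; a second application of Markov's
  inequality restores both.
\<close>

lemma sparse_parts_step:
  assumes D: "sparse_pair t (a + 5) g"
  shows "sparse_parts t a (k * (g + 1) + 1)"
  unfolding sparse_parts_def
proof (intro allI impI, elim conjE)
  fix U assume U: "U \<subseteq> X" "n ^ (k * (g + 1) + 1) \<le> card U"
  have "n ^ (k * (g + 1)) \<le> n ^ (k * (g + 1) + 1)" using n3 by (intro power_increasing) auto
  then have big: "n ^ (k * (g + 1)) \<le> card U" using U(2) by (rule le_trans)
  \<comment> \<open>Of the 5 in \<open>a + 5\<close>, the tree uses 2, the second Markov step 2, and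
    restricting the target part to its good vertices 1.\<close>
  have "sparse_pair t (a + 3 + 2) g"
  proof -
    have "a + 3 + 2 = a + 5" by simp
    with D show ?thesis by (simp only:)
  qed
  from sparse_tree[OF this _ U(1) big] obtain L where L: "length L = m"
    "sorted_wrt (\<lambda>P Q. P \<lless> Q \<and>
       (sparse (low t) (n ^ (a + 3)) P Q \<or> sparse (low t) (n ^ (a + 3)) Q P)) L"
    "\<And>P. P \<in> set L \<Longrightarrow> P \<subseteq> U \<and> card U \<le> n ^ (k * (g + 1)) * card P"
    using m by blast
  \<comment> \<open>\<open>F i\<close> collects the parts already sparse towards
    \<open>L ! i\<close>; \<open>P i\<close> keeps the vertices of \<open>L ! i\<close> that are
    sparse in return.\<close>
  define F where "F i = {Q\<in>set L. sparse (low t) (n ^ (a + 3)) Q (L ! i)}" for i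
  define P where "P i = {y\<in>L ! i. \<forall>Q\<in>F i. n ^ (a + 1) * card {x\<in>Q. low t y x} \<le> card Q}" for i
  have Psub: "P i \<subseteq> L ! i" for i by (auto simp: P_def)
  have finL: "finite Q" if "Q \<in> set L" for Q using L(3)[OF that] U finX by (meson finite_subset)
  have half: "card (L ! i) \<le> n * card (P i)" if i: "i < m" for i
  proof -
    have "card (L ! i) \<le> 2 * card (P i)"
      unfolding P_def
    proof (rule markov_family[where p' = "n ^ (a + 3)" and r = m])
      show "finite (L ! i)" using finL i L(1) by simp
      have "card (F i) \<le> card (set L)" by (intro card_mono) (auto simp: F_def)
      then show "card (F i) \<le> m" using card_length[of L] L(1) by simp
      have "2 * m * n ^ (a + 1) \<le> n ^ 2 * n ^ (a + 1)" using m2 by (rule mult_le_mono1)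
      then show "2 * m * n ^ (a + 1) \<le> n ^ (a + 3)" by (simp add: power_add eval_nat_numeral ac_simps)
    qed (use n3 finL in \<open>auto simp: F_def m insert_commute\<close>)
    also have "\<dots> \<le> n * card (P i)" using n3 by (intro mult_le_mono1) simp
    finally show ?thesis .
  qed
  have rel: "P i \<lless> P j \<and> sparse (low t) (n ^ a) (P i) (P j) \<and> sparse (low t) (n ^ a) (P j) (P i)"
    if ij: "i < j" "j < m" for i j
  proof -
    have 1: "n ^ (a + 1) * card {x\<in>L ! j'. low t y x} \<le> card (L ! j')"
      if i'j': "(i' = i \<and> j' = j) \<or> (i' = j \<and> j' = i)" and y: "y \<in> P i'" for i' j' y
    proof -
      have lt: "i' < m" "j' < m" using i'j' ij by auto
      have "sparse (low t) (n ^ (a + 3)) (L ! i') (L ! j') \<or>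
          sparse (low t) (n ^ (a + 3)) (L ! j') (L ! i')"
        using sorted_wrt_nth_less[OF L(2) ij(1)] ij L(1) i'j' by auto
      then show ?thesis
      proof
        assume sp: "sparse (low t) (n ^ (a + 3)) (L ! i') (L ! j')"
        have "n ^ (a + 1) * card {x\<in>L ! j'. low t y x} \<le> n ^ (a + 3) * card {x\<in>L ! j'. low t y x}"
          using n3 by (intro mult_le_mono1 power_increasing) auto
        also have "\<dots> \<le> card (L ! j')" using sp y Psub by (auto simp: sparse_def)
        finally show ?thesis .
      next
        assume "sparse (low t) (n ^ (a + 3)) (L ! j') (L ! i')"
        then have "L ! j' \<in> F i'" using lt L(1) by (auto simp: F_def)
        then show ?thesis using y by (auto simp: P_def)
      qed
    qed
    have 2: "sparse (low t) (n ^ a) (P i') (P j')"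
      if i'j': "(i' = i \<and> j' = j) \<or> (i' = j \<and> j' = i)" for i' j'
      unfolding sparse_def
    proof
      fix y assume y: "y \<in> P i'"
      have lt: "j' < m" using i'j' ij by auto
      have "n ^ (a + 1) * card {x\<in>P j'. low t y x} \<le> n ^ (a + 1) * card {x\<in>L ! j'. low t y x}"
        using Psub finL[of "L ! j'"] lt L(1) by (intro mult_le_mono2 card_mono) auto
      also have "\<dots> \<le> card (L ! j')" using 1 i'j' y by blast
      also have "\<dots> \<le> n * card (P j')" using half lt by blast
      finally show "n ^ a * card {x\<in>P j'. low t y x} \<le> card (P j')" using n3 by simp
    qed
    have "L ! i \<lless> L ! j" using sorted_wrt_nth_less[OF L(2) ij(1)] ij L(1) by simp
    then show ?thesis using set_less_mono[OF _ Psub Psub] 2[of i j] 2[of j i] by simp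
  qed
  have "P i \<subseteq> U \<and> card U \<le> n ^ (k * (g + 1) + 1) * card (P i)" if i: "i < m" for i
  proof -
    have Li: "L ! i \<in> set L" using i L(1) by simp
    have "card U \<le> n ^ (k * (g + 1)) * card (L ! i)" using L(3) Li by blast
    also have "\<dots> \<le> n ^ (k * (g + 1)) * (n * card (P i))" using half[OF i] by (rule mult_le_mono2)
    finally show ?thesis using Psub L(3)[OF Li] by (auto simp: ac_simps)
  qed
  then show "\<exists>P. (\<forall>i<m. P i \<subseteq> U \<and> card U \<le> n ^ (k * (g + 1) + 1) * card (P i)) \<and>
        (\<forall>i<m. \<forall>j<m. i < j \<longrightarrow> P i \<lless> P j) \<and>
        (\<forall>i<m. \<forall>j<m. i \<noteq> j \<longrightarrow> sparse (low t) (n ^ a) (P i) (P j))"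
    using rel by (intro exI[of _ P]) (auto elim!: linorder_neqE_nat)
qed

section \<open>The exponent recursion and the last color\<close>

text \<open>
  The bound is \<open>s \<le> (2 (k d)^t - 2) (a + 14) + 3\<close>, written without subtraction.
\<close>

lemma sparse_parts_exponent:
  assumes "2 \<le> d" "1 \<le> k" "t < q"
  shows "\<exists>s. sparse_parts t a s \<and> s + 2 * (a + 14) \<le> 2 * (k * d) ^ t * (a + 14) + 3"
  using assms(3)
proof (induction t arbitrary: a)
  case 0
  show ?case by (intro exI[of _ 2]) (simp add: sparse_parts_0)
next
  case (Suc t)
  \<comment> \<open>The sparseness demanded by the pair step when \<open>a + 5\<close> stands for
    its \<open>a\<close>.\<close>
  define b where "b = d * (a + 6) + 2"
  obtain s where s: "sparse_parts t b s" "s + 2 * (b + 14) \<le> 2 * (k * d) ^ t * (b + 14) + 3"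
    using Suc by fastforce
  define g where "g = s + d * (a + 6) + 3"
  have "sparse_pair (Suc t) (a + 5) g"
    using sparse_pair_step[of t "a + 5" s] s Suc.prems by (simp add: b_def g_def add.commute)
  then have "sparse_parts (Suc t) a (k * (g + 1) + 1)" by (rule sparse_parts_step)
  moreover have "k * (g + 1) + 1 + 2 * (a + 14) \<le> 2 * (k * d) ^ Suc t * (a + 14) + 3"
  proof -
    define y where "y = (k * d) ^ t"
    have y: "1 \<le> y" using assms by (simp add: y_def)
    \<comment> \<open>This fixes the constant 14: the inequality amounts to
      \<open>16 <= 8 * d\<close>, with equality at \<open>d = 2\<close>.\<close>
    have bd: "b + 14 \<le> d * (a + 14)" using assms(1) by (simp add: b_def algebra_simps)
    have kd: "k * 2 \<le> k * d" and kd2: "2 \<le> k * d"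
      using assms mult_le_mono[of 1 k 2 d] by simp_all
    obtain z where z: "y = 1 + z" using y le_Suc_ex by blast
    have "s \<le> 2 * z * (b + 14) + 3"
      using s(2) unfolding y_def[symmetric] z by (simp add: algebra_simps)
    also have "\<dots> \<le> 2 * z * (d * (a + 14)) + 3" using bd by simp
    finally have "k * (g + 1) \<le> k * (2 * z * (d * (a + 14)) + 3 + d * (a + 6) + 4)"
      by (intro mult_le_mono2) (simp add: g_def)
    also have "\<dots> = 2 * z * (k * d) * (a + 14) + k * d * (a + 6) + 7 * k"
      by (simp add: algebra_simps)
    also have "\<dots> + 1 + 2 * (a + 14) \<le> 2 * z * (k * d) * (a + 14) + 2 * (k * d) * (a + 14) + 3"
    proof -
      have "2 * (a + 14) \<le> k * d * (a + 14)" using kd2 by (intro mult_le_mono1)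
      moreover have "7 * k + 1 \<le> 8 * (k * d) + 3" using kd by linarith
      ultimately show ?thesis by (simp add: algebra_simps)
    qed
    finally show ?thesis unfolding power_Suc y_def[symmetric] z by (simp add: algebra_simps)
  qed
  ultimately show ?case by blast
qed

text \<open>An embedding that avoids all colors below \<open>q - 1\<close> on the edges is
  monochromatic in color \<open>q - 1\<close>. Of the exponent 4, the blocks use 2, the greedy
  choice 1, and strictness of its inequality 1.\<close>

lemma last_color_contradiction:
  assumes S: "sparse_parts (q - 1) 4 s" and X: "n ^ (s + 1) \<le> card X" and q: "0 < q"
    and c: "c \<in> [X]\<^bsup>2\<^esup> \<rightarrow> {..<q}"
  shows False
proof -
  have "n ^ s \<le> n ^ (s + 1)" using n3 by (intro power_increasing) auto
  then have "n ^ s \<le> card X" using X by (rule le_trans)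
  from sparse_partsD[OF S order.refl this] obtain P :: "nat \<Rightarrow> 'b set" where P': "\<forall>i<m. P i \<subseteq> X"
    "\<forall>i<m. card X \<le> n ^ s * card (P i)" "\<forall>i<m. \<forall>j<m. i < j \<longrightarrow> P i \<lless> P j"
    "\<forall>i<m. \<forall>j<m. i \<noteq> j \<longrightarrow> sparse (low (q - 1)) (n ^ 4) (P i) (P j)"
    by blast
  note P = P'[rule_format]
  have "\<forall>i<m. n \<le> card (P i)"
    using power_le_card_factor[OF X P(2)] by simp
  from blocks[OF P'(1) this P'(3)] obtain W where W': "\<forall>v\<in>V. W v \<subseteq> P (p v)"
    "\<forall>v\<in>V. card (P (p v)) \<le> n ^ 2 * card (W v)" "\<forall>v\<in>V. W v \<noteq> {}"
    "\<forall>u\<in>V. \<forall>v\<in>V. u < v \<longrightarrow> W u \<lless> W v"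
    by blast
  note W = W'[rule_format]
  have WX: "W v \<subseteq> X" if "v \<in> V" for v
    using W(1)[OF that] P(1)[OF p_less[OF that]] by auto
  have finW: "finite (W v)" if "v \<in> V" for v using finite_subset[OF WX[OF that] finX] .
  obtain f where f: "\<And>v. v \<in> V \<Longrightarrow> f v \<in> W v"
    "\<And>u v. u \<in> V \<Longrightarrow> v \<in> V \<Longrightarrow> {u, v} \<in> E \<Longrightarrow> \<not> low (q - 1) (f u) (f v)"
  proof (rule avoiding_embedding[of "low (q - 1)" E V n W])
    fix u v x assume uv: "u \<in> V" "v \<in> V" "{u, v} \<in> E" and x: "x \<in> W u"
    define D where "D = {y\<in>W v. low (q - 1) x y}"
    have "n ^ 4 * card D \<le> n ^ 4 * card {y\<in>P (p v). low (q - 1) x y}"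
      using W(1)[OF uv(2)] P(1)[OF p_less[OF uv(2)]] finX
      by (intro mult_le_mono2 card_mono) (auto simp: D_def intro: finite_subset)
    also have "\<dots> \<le> card (P (p v))"
      using P(4)[of "p u" "p v"] p_less uv p_neq x W(1)[OF uv(1)] by (auto simp: sparse_def)
    also have "\<dots> \<le> n ^ 2 * card (W v)" using W(2) uv by blast
    also have "n ^ 4 * card D = n ^ 2 * (n * n * card D)" by (simp add: eval_nat_numeral)
    finally have *: "n * n * card D \<le> card (W v)" using n3 by (subst (asm) mult_le_cancel1) auto
    have pos: "0 < card (W v)" using W(3) finW uv by (simp add: card_gt_0_iff)
    show "n * card {y\<in>W v. low (q - 1) x y} < card (W v)"
    proof (cases "card D = 0")
      case True
      then show ?thesis using pos by (simp add: D_def)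
    next
      case False
      then have "n * card D < n * n * card D" using n3 by simp
      with * show ?thesis unfolding D_def by linarith
    qed
  qed (use finV cardV finW W(3) card_edge in \<open>auto simp: insert_commute\<close>)
  have "ordered_copy f V E X ([X]\<^bsup>2\<^esup>)" using f(1) WX W(4) by (rule ordered_copyI)
  then have edge: "{f u, f v} \<in> [X]\<^bsup>2\<^esup>" if "{u, v} \<in> E" for u v
    using edge_vertices[OF that] that by (auto simp: ordered_copy_def)
  have "\<exists>u v. {u, v} \<in> E \<and> c {f u, f v} \<noteq> q - 1"
    using q by (intro no_monochromatic_transversal[OF f(1) WX W(4)]) auto
  then obtain u v where uv: "{u, v} \<in> E" "c {f u, f v} \<noteq> q - 1" by blast
  have "c {f u, f v} < q" using c edge[OF uv(1)] by auto
  then show False using f(2)[of u v] uv edge_vertices[OF uv(1)] by auto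
qed

end

section \<open>The bound on the ordered Ramsey number\<close>

theorem corollary4:
  fixes V :: "'a::linorder set" and E :: "'a set set" and d q n \<chi> :: nat
  assumes "d \<ge> 2" and "q \<ge> 2"
    and "ordered_graph V E"
    and "degenerate d V E"
    and "card V = n" and "n \<ge> 3"
    and "E \<noteq> {}"
    and "interval_chromatic_number V E = \<chi>"
  shows "ordered_ramsey V E q \<le> n ^ (60 * d ^ (q - 1) * nat \<lceil>log 2 (real \<chi>)\<rceil> ^ (q - 1))"
proof -
  define k where "k = nat \<lceil>log 2 (real \<chi>)\<rceil>"
  define N where "N = n ^ (60 * d ^ (q - 1) * k ^ (q - 1))"
  have fin: "finite V" and E: "E \<subseteq> [V]\<^bsup>2\<^esup>" using assms(3) by (auto simp: ordered_graph_def)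
  obtain p :: "'a \<Rightarrow> nat" where p: "\<chi> \<le> card V" "\<And>v. v \<in> V \<Longrightarrow> p v < \<chi>"
    "\<And>u v. u \<in> V \<Longrightarrow> v \<in> V \<Longrightarrow> u < v \<Longrightarrow> p u \<le> p v"
    "\<And>u v. u \<in> V \<Longrightarrow> v \<in> V \<Longrightarrow> {u, v} \<in> E \<Longrightarrow> p u \<noteq> p v"
    using interval_classes[OF fin E assms(8)] by metis
  obtain u v where uv: "{u, v} \<in> E" "u \<in> V" "v \<in> V"
  proof -
    obtain e where e: "e \<in> E" using assms(7) by blast
    then have "card e = 2" "e \<subseteq> V" using E by (auto simp: nsets_def)
    then show thesis using that e by (auto simp: card_2_iff)
  qed
  \<comment> \<open>The ends of an edge have different labels, so there are at least two intervals;
    this gives \<open>k >= 1\<close>.\<close>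
  have chi: "2 \<le> \<chi>" using p(2)[OF uv(2)] p(2)[OF uv(3)] p(4)[OF uv(2,3,1)] by linarith
  have "log 2 2 \<le> log 2 (real \<chi>)" using chi by (subst log_le_cancel_iff) auto
  then have log1: "1 \<le> log 2 (real \<chi>)" by simp
  then have k1: "1 \<le> k" by (simp add: k_def) linarith
  have kr: "real k = of_int \<lceil>log 2 (real \<chi>)\<rceil>" using log1 by (simp add: k_def)
  have chi_le: "\<chi> \<le> 2 ^ k"
  proof -
    have "log 2 (real \<chi>) \<le> real k" unfolding kr by (rule le_of_int_ceiling)
    then have "real \<chi> \<le> 2 powr real k" using chi by (simp add: log_le_iff)
    then show ?thesis by (simp add: powr_realpow)
  qed
  have less_chi: "2 ^ (k - 1) < \<chi>"
  proof -
    have "real (k - 1) < log 2 (real \<chi>)" using kr k1 by linarith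
    then have "2 powr real (k - 1) < real \<chi>" using chi by (simp add: less_log_iff)
    then show ?thesis by (simp add: powr_realpow)
  qed
  \<comment> \<open>Since \<open>2 ^ (k - 1) < \<chi>\<close> and \<open>\<chi> \<le> n\<close>, the
    left side is at most \<open>4 * (n - 1)\<close>, and \<open>(n - 2) ^ 2 >= 0\<close>
    finishes.\<close>
  have m2: "2 * 2 ^ k \<le> n ^ 2"
  proof -
    have "(2::nat) ^ k = 2 * 2 ^ (k - 1)" using k1 by (cases k) auto
    then have "2 * 2 ^ k + 4 \<le> 4 * n" using less_chi p(1) assms(5) by simp
    moreover have "4 * n \<le> n ^ 2 + 4"
    proof -
      obtain r where "n = 2 + r" using assms(6) le_Suc_ex[of 2 n] by auto
      then show ?thesis by (simp add: power2_eq_square)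
    qed
    ultimately show ?thesis by linarith
  qed
  have "\<exists>f. \<exists>i<q. ordered_copy f V E {..<N} ([{..<N}]\<^bsup>2\<^esup>) \<and> (\<forall>e\<in>E. c (f ` e) = i)"
    if c: "c \<in> [{..<N}]\<^bsup>2\<^esup> \<rightarrow> {..<q}" for c
  proof (rule ccontr)
    assume no: "\<not> ?thesis"
    interpret ordered_coloring V E d n k "2 ^ k" q p "{..<N}" c
    proof
      show "p v < 2 ^ k" if "v \<in> V" for v using p(2)[OF that] chi_le by linarith
    qed (use fin E assms m2 p no in auto)
    have "q - 1 < q" using assms(2) by simp
    \<comment> \<open>The last color needs sparseness exponent 4, and
      \<open>2 * (4 + 14) = 36\<close> stays below 60.\<close>
    from sparse_parts_exponent[OF assms(1) k1 this, of 4] obtain s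
      where s: "sparse_parts (q - 1) 4 s" "s + 36 \<le> 36 * (k * d) ^ (q - 1) + 3"
      by auto
    have "s + 1 \<le> 60 * d ^ (q - 1) * k ^ (q - 1)"
      using s(2) by (simp add: power_mult_distrib mult.commute mult.left_commute)
    then have "n ^ (s + 1) \<le> card {..<N}"
      unfolding N_def card_lessThan using assms(6) by (intro power_increasing) auto
    with s(1) show False using c assms(2) by (intro last_color_contradiction) auto
  qed
  then show ?thesis
    unfolding ordered_ramsey_def k_def[symmetric] N_def[symmetric] by (intro Least_le) blast
qed

end
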